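(* Let $n\ge 1$ and let $G$ be a non-abelian subgroup of $\mathcal{H}(n,\mathbb{R})$. Then: (i) If $G\setminus\mathcal{S}_n\neq\emptyset$, then $G$ has no periodic orbit in $\mathbb{R}^n$. Moreover, if in addition $G$ is countable, then $G$ has no closed orbit. (ii) If $G\subset\mathcal{S}_n$, then every orbit of $G$ is minimal in $\mathbb{R}^n$.
   Context: $\mathcal{H}(n,\mathbb{R})$ is the group (under composition) of all maps $x\mapsto\lambda x+a$ of $\mathbb{R}^n$ with $\lambda\in\mathbb{R}\setminus\{0\}$ and $a\in\mathbb{R}^n$. $\mathcal{S}_n$ is its subgroup of maps $x\mapsto\varepsilon x+a$ with $\varepsilon\in\{-1,1\}$. For $v\in\mathbb{R}^n$, $G(v)=\{f(v):f\in G\}$ is the orbit of $v$. A periodic orbit is a finite orbit. An orbit $G(v)$ is minimal in $\mathbb{R}^n$ if $\overline{G(w)}=\overline{G(v)}$ for every $w\in\overline{G(v)}$. *)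

theory Defs
  imports "HOL-Analysis.Analysis" "HOL-Algebra.Group"
begin

definition homothety :: "real \<Rightarrow> real ^ 'n \<Rightarrow> real ^ 'n \<Rightarrow> real ^ 'n" where
  "homothety l a = (\<lambda>x. l *\<^sub>R x + a)"

definition homothety_group :: "(real ^ 'n \<Rightarrow> real ^ 'n) monoid" where
  "homothety_group = \<lparr>carrier = {homothety l a | l a. l \<noteq> 0}, mult = (\<circ>), one = id\<rparr>"

definition sym_trans :: "(real ^ 'n \<Rightarrow> real ^ 'n) set" where
  "sym_trans = {homothety e a | e a. e \<in> {-1, 1}}"

definition orbit :: "(real ^ 'n \<Rightarrow> real ^ 'n) set \<Rightarrow> real ^ 'n \<Rightarrow> (real ^ 'n) set" where
  "orbit G v = {f v | f. f \<in> G}"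

definition periodic_orbit :: "(real ^ 'n \<Rightarrow> real ^ 'n) set \<Rightarrow> real ^ 'n \<Rightarrow> bool" where
  "periodic_orbit G v \<longleftrightarrow> finite (orbit G v)"

definition minimal_orbit :: "(real ^ 'n \<Rightarrow> real ^ 'n) set \<Rightarrow> real ^ 'n \<Rightarrow> bool" where
  "minimal_orbit G v \<longleftrightarrow>
     (\<forall>w \<in> closure (orbit G v). closure (orbit G w) = closure (orbit G v))"

lemma homothety_comp:
  "homothety l a \<circ> homothety m b = homothety (l * m) (l *\<^sub>R b + a)"
  by (auto simp: homothety_def fun_eq_iff scaleR_add_right)

lemma homothety_id: "homothety 1 0 = id"
  by (auto simp: homothety_def)

lemma homothety_inverse:
  "l \<noteq> 0 \<Longrightarrow> homothety (inverse l) (- (inverse l *\<^sub>R a)) \<circ> homothety l a = id"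
  by (simp add: homothety_comp homothety_id)

lemma group_homothety_group: "Group.group (homothety_group :: (real ^ 'n \<Rightarrow> real ^ 'n) monoid)"
proof (rule groupI)
  fix f g :: "real ^ 'n \<Rightarrow> real ^ 'n"
  assume "f \<in> carrier homothety_group" "g \<in> carrier homothety_group"
  then obtain l a m b where f: "f = homothety l a" "l \<noteq> 0" and g: "g = homothety m b" "m \<noteq> 0"
    unfolding homothety_group_def by (simp, blast)
  have "f \<circ> g = homothety (l * m) (l *\<^sub>R b + a)" "l * m \<noteq> 0"
    by (simp_all only: f g homothety_comp mult_eq_0_iff not_False_eq_True simp_thms)
  then show "f \<otimes>\<^bsub>homothety_group\<^esub> g \<in> carrier homothety_group"
    unfolding homothety_group_def by (simp, blast)
next
  have "(id :: real ^ 'n \<Rightarrow> real ^ 'n) = homothety 1 0" "(1::real) \<noteq> 0"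
    by (simp_all only: homothety_id one_neq_zero not_False_eq_True)
  then show "\<one>\<^bsub>homothety_group\<^esub> \<in> carrier (homothety_group :: (real ^ 'n \<Rightarrow> real ^ 'n) monoid)"
    unfolding homothety_group_def by (simp, blast)
next
  fix f :: "real ^ 'n \<Rightarrow> real ^ 'n"
  assume "f \<in> carrier homothety_group"
  then obtain l a where f: "f = homothety l a" "l \<noteq> 0"
    unfolding homothety_group_def by (simp, blast)
  define g where "g = homothety (inverse l) (- (inverse l *\<^sub>R a))"
  have "inverse l \<noteq> 0" using f(2) by simp
  then have "g \<in> carrier homothety_group"
    unfolding g_def homothety_group_def by (simp, blast)
  moreover have "g \<otimes>\<^bsub>homothety_group\<^esub> f = \<one>\<^bsub>homothety_group\<^esub>"
    unfolding g_def f(1) homothety_group_def using homothety_inverse[OF f(2)] by simp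
  ultimately show "\<exists>g \<in> carrier homothety_group. g \<otimes>\<^bsub>homothety_group\<^esub> f = \<one>\<^bsub>homothety_group\<^esub>"
    by blast
qed (simp_all add: homothety_group_def comp_assoc)

lemma subgroup_sym_trans:
  "subgroup sym_trans (homothety_group :: (real ^ 'n \<Rightarrow> real ^ 'n) monoid)"
proof (rule group.subgroupI[OF group_homothety_group])
  have "e \<noteq> 0" if "e \<in> {-1, 1}" for e :: real
    using that by auto
  then show sub: "sym_trans \<subseteq> carrier (homothety_group :: (real ^ 'n \<Rightarrow> real ^ 'n) monoid)"
    unfolding sym_trans_def homothety_group_def by (simp only: partial_object.simps) blast
  show "sym_trans \<noteq> ({} :: (real ^ 'n \<Rightarrow> real ^ 'n) set)"
    unfolding sym_trans_def by blast
  fix f :: "real ^ 'n \<Rightarrow> real ^ 'n"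
  assume f: "f \<in> sym_trans"
  then obtain e a where e: "f = homothety e a" "e \<in> {-1, 1}"
    unfolding sym_trans_def by blast
  then have e': "e \<noteq> 0" "inverse e \<in> {-1, 1}" by auto
  define g where "g = homothety (inverse e) (- (inverse e *\<^sub>R a))"
  have g: "g \<in> sym_trans"
    using e'(2) unfolding g_def sym_trans_def by blast
  have "g \<otimes>\<^bsub>homothety_group\<^esub> f = \<one>\<^bsub>homothety_group\<^esub>"
    unfolding g_def e(1) homothety_group_def using homothety_inverse[OF e'(1)] by simp
  then have "inv\<^bsub>homothety_group\<^esub> f = g"
    using group.inv_equality[OF group_homothety_group] sub f g by blast
  then show "inv\<^bsub>homothety_group\<^esub> f \<in> sym_trans"
    using g by simp
  fix h :: "real ^ 'n \<Rightarrow> real ^ 'n"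
  assume "h \<in> sym_trans"
  then obtain d b where d: "h = homothety d b" "d \<in> {-1, 1}"
    unfolding sym_trans_def by blast
  have "f \<circ> h = homothety (e * d) (e *\<^sub>R b + a)"
    by (simp only: e d homothety_comp)
  moreover have "e * d \<in> {-1, 1}"
    using e(2) d(2) by auto
  ultimately have "f \<circ> h \<in> sym_trans"
    unfolding sym_trans_def by blast
  then show "f \<otimes>\<^bsub>homothety_group\<^esub> h \<in> sym_trans"
    by (simp add: homothety_group_def)
qed

end

theory Submission
  imports Defs
begin

text \<open>
  A non-trivial commutator in \<open>G\<close> is a translation by some \<open>t \<noteq> 0\<close>, so every orbit contains all
  integer translates along \<open>t\<close> and is infinite. If \<open>G\<close> contains a map with ratio \<open>l\<close>,
  \<open>\<bar>l\<bar> < 1\<close>, conjugation by its powers yields the translations by \<open>l ^ k *\<^sub>R t\<close>; their integer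
  multiples are dense in the line spanned by \<open>t\<close>, so a closed orbit contains a whole line and is
  uncountable. If \<open>G\<close> consists of isometries, \<open>g v\<close> is close to \<open>w\<close> iff \<open>g\<inverse> w\<close> is close to \<open>v\<close>,
  so orbit closures that meet coincide.
\<close>

lemma homothety_apply: "homothety l a x = l *\<^sub>R x + a"
  by (simp add: homothety_def)

lemma homothety_group_simps:
  "f \<otimes>\<^bsub>homothety_group\<^esub> g = f \<circ> g" "\<one>\<^bsub>homothety_group\<^esub> = id"
  by (simp_all add: homothety_group_def)

lemma subgroup_homothety_elem:
  assumes "subgroup G homothety_group" "f \<in> G"
  obtains l a where "f = homothety l a" "l \<noteq> 0"
  using subgroup.subset[OF assms(1)] assms(2) by (auto simp: homothety_group_def)

lemma subgroup_homothety_comp: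
  assumes "subgroup G homothety_group" "f \<in> G" "g \<in> G"
  shows "f \<circ> g \<in> G"
  using subgroup.m_closed[OF assms] by (simp add: homothety_group_simps)

text \<open>Identifies the abstract group inverse with an explicit homothety, so that closure of
  \<open>G\<close> under inverses yields concrete ratios and vectors.\<close>

lemma subgroup_homothety_inverse:
  fixes G :: "(real ^ 'n \<Rightarrow> real ^ 'n) set"
  assumes G: "subgroup G homothety_group" and f: "homothety l a \<in> G" and l: "l \<noteq> 0"
  shows "homothety (inverse l) (- (inverse l *\<^sub>R a)) \<in> G"
proof -
  let ?H = "homothety_group :: (real ^ 'n \<Rightarrow> real ^ 'n) monoid"
  let ?g = "homothety (inverse l) (- (inverse l *\<^sub>R a))"
  have car: "homothety m b \<in> carrier ?H" if "m \<noteq> 0" for m b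
    using that by (auto simp: homothety_group_def)
  \<comment> \<open>In a group a left inverse is the inverse; \<open>car\<close> puts both maps into
    the carrier.\<close>
  have "inv\<^bsub>?H\<^esub> (homothety l a) = ?g"
    using group.inv_equality[OF group_homothety_group, of ?g "homothety l a"]
      homothety_inverse[OF l, of a] car l
    by (simp add: homothety_group_simps)
  then show ?thesis
    using subgroup.m_inv_closed[OF G f] by simp
qed

lemma orbit_mem_iff: "x \<in> orbit G v \<longleftrightarrow> (\<exists>f\<in>G. x = f v)"
  by (auto simp: orbit_def)

lemma translate_mem_orbit: "homothety 1 t \<in> G \<Longrightarrow> v + t \<in> orbit G v"
  unfolding orbit_mem_iff by (rule bexI[of _ "homothety 1 t"]) (simp_all add: homothety_apply)

text \<open>Ratios commute, so \<open>f \<circ> g\<close> and \<open>g \<circ> f\<close> have the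
  same ratio and can differ only in their vectors \<open>p\<close> and \<open>q\<close>. Composing
  the first with the inverse of the second therefore leaves the translation by \<open>p - q\<close>,
  and \<open>p = q\<close> would make \<open>f\<close> and \<open>g\<close> commute.\<close>

lemma noncommutative_translation:
  fixes G :: "(real ^ 'n \<Rightarrow> real ^ 'n) set"
  assumes G: "subgroup G homothety_group"
    and nc: "\<not> comm_group (homothety_group\<lparr>carrier := G\<rparr>)"
  obtains t where "t \<noteq> 0" "homothety 1 t \<in> G"
proof -
  have "group (homothety_group\<lparr>carrier := G\<rparr>)"
    using subgroup.subgroup_is_group[OF G group_homothety_group] .
  with nc obtain f g where fg: "f \<in> G" "g \<in> G" "f \<circ> g \<noteq> g \<circ> f"
    using group.group_comm_groupI[of "homothety_group\<lparr>carrier := G\<rparr>"]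
    by (auto simp: homothety_group_simps)
  obtain l a where f: "f = homothety l a" "l \<noteq> 0"
    using subgroup_homothety_elem[OF G fg(1)] .
  obtain m b where g: "g = homothety m b" "m \<noteq> 0"
    using subgroup_homothety_elem[OF G fg(2)] .
  define p q where "p = l *\<^sub>R b + a" and "q = m *\<^sub>R a + b"
  have fg': "f \<circ> g = homothety (l * m) p" and gf': "g \<circ> f = homothety (l * m) q"
    by (simp_all add: f g homothety_comp p_def q_def mult.commute)
  have lm: "l * m \<noteq> 0" using f g by simp
  have "homothety (l * m) q \<in> G"
    using subgroup_homothety_comp[OF G fg(2,1)] gf' by simp
  then have "homothety (inverse (l * m)) (- (inverse (l * m) *\<^sub>R q)) \<in> G"
    by (rule subgroup_homothety_inverse[OF G _ lm])
  then have "homothety (l * m) p \<circ> homothety (inverse (l * m)) (- (inverse (l * m) *\<^sub>R q)) \<in> G"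
    using subgroup_homothety_comp[OF G] subgroup_homothety_comp[OF G fg(1,2)] fg' by metis
  then have "homothety 1 (p - q) \<in> G"
    using lm unfolding homothety_comp by (simp del: inverse_mult_distrib)
  moreover have "p - q \<noteq> 0" using fg(3) fg' gf' by auto
  ultimately show ?thesis using that by blast
qed

lemma translation_of_int_multiple:
  assumes G: "subgroup G homothety_group" and t: "homothety 1 t \<in> G"
  shows "homothety 1 (of_int k *\<^sub>R t) \<in> G"
proof (induction k rule: int_induct[where k = 0])
  case base
  have "homothety 1 (of_int 0 *\<^sub>R t) = id"
    by (simp add: homothety_apply fun_eq_iff)
  then show ?case
    using subgroup.one_closed[OF G] unfolding homothety_group_simps by metis
next
  case (step1 i)
  show ?case
    using subgroup_homothety_comp[OF G t step1(2)]
    by (simp add: homothety_comp scaleR_add_left)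
next
  \<comment> \<open>The downward step composes with the inverse translation, by
    \<open>- t\<close>.\<close>
  case (step2 i)
  have "homothety 1 (- t) \<in> G"
    using subgroup_homothety_inverse[OF G t] by simp
  then show ?case
    using subgroup_homothety_comp[OF G _ step2(2)]
    by (fastforce simp: homothety_comp scaleR_diff_left)
qed

text \<open>Conjugating a translation by a map of ratio \<open>l\<close> cancels the vector
  \<open>a\<close> and multiplies the translation vector by \<open>l\<close>.\<close>

lemma translation_conjugate:
  assumes G: "subgroup G homothety_group" and t: "homothety 1 t \<in> G"
    and f: "homothety l a \<in> G" "l \<noteq> 0"
  shows "homothety 1 (l *\<^sub>R t) \<in> G"
proof -
  have "homothety l a \<circ> homothety 1 t \<circ> homothety (inverse l) (- (inverse l *\<^sub>R a)) \<in> G"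
    by (intro subgroup_homothety_comp[OF G] subgroup_homothety_inverse[OF G] t f)
  then show ?thesis
    using f(2) by (simp add: homothety_comp)
qed

lemma translation_power_conjugate:
  assumes "subgroup G homothety_group" "homothety 1 t \<in> G" "homothety l a \<in> G" "l \<noteq> 0"
  shows "homothety 1 (l ^ k *\<^sub>R t) \<in> G"
proof (induction k)
  case (Suc k)
  show ?case
    using translation_conjugate[OF assms(1) Suc assms(3,4)] by simp
qed (use assms in simp)

text \<open>Outside \<open>sym_trans\<close> the ratio has absolute value other than 1; if it
  exceeds 1, the inverse map contracts.\<close>

lemma contracting_ratio:
  assumes G: "subgroup G homothety_group" and ne: "G - sym_trans \<noteq> {}"
  obtains l a where "homothety l a \<in> G" "l \<noteq> 0" "\<bar>l\<bar> < 1"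
proof -
  obtain f where f: "f \<in> G" "f \<notin> sym_trans" using ne by blast
  obtain l a where la: "f = homothety l a" "l \<noteq> 0"
    using subgroup_homothety_elem[OF G f(1)] .
  have "\<bar>l\<bar> \<noteq> 1"
    using f(2) la(1) unfolding sym_trans_def by (auto simp: abs_if split: if_splits)
  then consider "\<bar>l\<bar> < 1" | "\<bar>l\<bar> > 1" by linarith
  then show ?thesis
  proof cases
    case 1
    then show ?thesis using that f(1) la by blast
  next
    case 2
    then have "\<bar>inverse l\<bar> < 1" by (simp add: abs_inverse inverse_less_1_iff)
    then show ?thesis
      using that[OF subgroup_homothety_inverse[OF G]] f(1) la by simp
  qed
qed

text \<open>Rounds \<open>s\<close> to a point of the grid of integer multiples of
  \<open>l ^ k\<close>. The floor is off by at most 1, so the error is at most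
  \<open>\<bar>l\<bar> ^ k\<close>, whatever the sign of \<open>l\<close>.\<close>

lemma int_multiples_of_powers_tendsto:
  fixes l s :: real
  assumes "l \<noteq> 0" "\<bar>l\<bar> < 1"
  shows "(\<lambda>k. of_int \<lfloor>s / l ^ k\<rfloor> * l ^ k) \<longlonglongrightarrow> s"
proof (rule LIM_zero_cancel, rule Lim_null_comparison)
  show "(\<lambda>k. \<bar>l\<bar> ^ k) \<longlonglongrightarrow> 0"
    using assms by (intro LIMSEQ_power_zero) simp
  have "norm (of_int \<lfloor>s / l ^ k\<rfloor> * l ^ k - s) \<le> \<bar>l\<bar> ^ k" for k
  proof -
    have "of_int \<lfloor>s / l ^ k\<rfloor> * l ^ k - s = (of_int \<lfloor>s / l ^ k\<rfloor> - s / l ^ k) * l ^ k"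
      using assms by (simp add: left_diff_distrib)
    moreover have "\<bar>of_int \<lfloor>s / l ^ k\<rfloor> - s / l ^ k\<bar> \<le> 1" by linarith
    ultimately show ?thesis
      by (simp add: abs_mult power_abs mult_left_le_one_le)
  qed
  then show "\<forall>\<^sub>F k in sequentially. norm (of_int \<lfloor>s / l ^ k\<rfloor> * l ^ k - s) \<le> \<bar>l\<bar> ^ k"
    by simp
qed

lemma translation_orbit_infinite:
  assumes G: "subgroup G homothety_group" and t: "homothety 1 t \<in> G" "t \<noteq> 0"
  shows "infinite (orbit G v)"
proof
  assume "finite (orbit G v)"
  moreover have "range (\<lambda>k::int. v + of_int k *\<^sub>R t) \<subseteq> orbit G v"
    using translate_mem_orbit[OF translation_of_int_multiple[OF G t(1)]] by (rule image_subsetI)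
  moreover have "inj (\<lambda>k::int. v + of_int k *\<^sub>R t)"
    using t(2) by (auto intro!: injI)
  ultimately show False
    using finite_subset finite_imageD infinite_UNIV_int by metis
qed

text \<open>Each approximation of \<open>s\<close> by an integer multiple of \<open>l ^ k\<close>
  gives a translation in \<open>G\<close>, hence a point of the orbit; closedness keeps the limit in
  it.\<close>

lemma closed_orbit_contains_line:
  assumes G: "subgroup G homothety_group" and t: "homothety 1 t \<in> G"
    and f: "homothety l a \<in> G" "l \<noteq> 0" "\<bar>l\<bar> < 1"
    and cl: "closed (orbit G v)"
  shows "v + s *\<^sub>R t \<in> orbit G v"
proof (rule closed_sequentially[OF cl])
  let ?c = "\<lambda>k. of_int \<lfloor>s / l ^ k\<rfloor> * l ^ k"
  show "v + ?c k *\<^sub>R t \<in> orbit G v" for k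
    using translate_mem_orbit[OF translation_of_int_multiple[OF G translation_power_conjugate[OF G t f(1,2)]]]
    by simp
  show "(\<lambda>k. v + ?c k *\<^sub>R t) \<longlonglongrightarrow> v + s *\<^sub>R t"
    by (intro tendsto_intros int_multiples_of_powers_tendsto f)
qed

lemma closed_orbit_uncountable:
  assumes "subgroup G homothety_group" "homothety 1 t \<in> G" "t \<noteq> 0"
    and "homothety l a \<in> G" "l \<noteq> 0" "\<bar>l\<bar> < 1" "closed (orbit G v)"
  shows "uncountable (orbit G v)"
proof
  assume "countable (orbit G v)"
  moreover have "range (\<lambda>s::real. v + s *\<^sub>R t) \<subseteq> orbit G v"
    using closed_orbit_contains_line assms by blast
  moreover have "inj (\<lambda>s::real. v + s *\<^sub>R t)"
    using assms(3) by (auto intro!: injI)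
  ultimately show False
    using countable_subset countable_image_inj_on uncountable_UNIV_real by metis
qed

text \<open>Every element of \<open>G\<close> is continuous and maps the orbit of \<open>v\<close>
  into itself, so it also preserves the closure. That closed set thus contains the whole orbit of
  each of its points.\<close>

lemma closure_orbit_mono:
  assumes G: "subgroup G homothety_group" and w: "w \<in> closure (orbit G v)"
  shows "closure (orbit G w) \<subseteq> closure (orbit G v)"
proof (rule closure_minimal)
  show "orbit G w \<subseteq> closure (orbit G v)"
  proof
    fix x assume "x \<in> orbit G w"
    then obtain f where f: "f \<in> G" "x = f w" by (auto simp: orbit_mem_iff)
    obtain l a where la: "f = homothety l a"
      using subgroup_homothety_elem[OF G f(1)] .
    have "continuous_on (closure (orbit G v)) f"
      unfolding la homothety_def by (intro continuous_intros)
    moreover have "f ` orbit G v \<subseteq> closure (orbit G v)"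
      using subgroup_homothety_comp[OF G f(1)] closure_subset[of "orbit G v"]
      by (fastforce simp: orbit_mem_iff)
    ultimately have "f ` closure (orbit G v) \<subseteq> closure (orbit G v)"
      by (intro image_closure_subset) auto
    with w f(2) show "x \<in> closure (orbit G v)" by blast
  qed
qed simp

lemma closure_orbit_sym:
  assumes G: "subgroup G homothety_group" and S: "G \<subseteq> sym_trans"
    and w: "w \<in> closure (orbit G v)"
  shows "v \<in> closure (orbit G w)"
  unfolding closure_approachable
proof (intro allI impI)
  fix e :: real assume "e > 0"
  then obtain x where "x \<in> orbit G v" "dist x w < e"
    using w unfolding closure_approachable by blast
  then obtain f where f: "f \<in> G" "dist (f v) w < e"
    by (auto simp: orbit_mem_iff)
  obtain l a where la: "f = homothety l a" "l = -1 \<or> l = 1"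
    using f(1) S by (auto simp: sym_trans_def)
  let ?g = "homothety (inverse l) (- (inverse l *\<^sub>R a))"
  have "?g \<in> G"
    using f(1) la by (intro subgroup_homothety_inverse[OF G]) auto
  \<comment> \<open>Here \<open>inverse l = l\<close> and \<open>l * l = 1\<close>, so
    \<open>?g w - v\<close> equals \<open>l\<close> times \<open>w - f v\<close>, and the factor
    \<open>l\<close> does not change the norm.\<close>
  moreover have "dist (?g w) v = dist (f v) w"
    using la(2) unfolding la(1) homothety_apply dist_norm
    by (auto simp: algebra_simps norm_minus_commute intro: arg_cong[where f = norm])
  ultimately show "\<exists>y\<in>orbit G w. dist y v < e"
    using f(2) by (intro bexI[of _ "?g w"]) (simp, unfold orbit_mem_iff, blast)
qed

theorem corollary1p3:
  fixes G :: "(real ^ 'n \<Rightarrow> real ^ 'n) set"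
  assumes "subgroup G homothety_group"
    and "\<not> comm_group (homothety_group\<lparr>carrier := G\<rparr>)"
  shows "(G - sym_trans \<noteq> {} \<longrightarrow>
            (\<forall>v. \<not> periodic_orbit G v) \<and>
            (countable G \<longrightarrow> (\<forall>v. \<not> closed (orbit G v))))
       \<and> (G \<subseteq> sym_trans \<longrightarrow> (\<forall>v. minimal_orbit G v))"
proof (intro conjI impI allI)
  obtain t where t: "t \<noteq> 0" "homothety 1 t \<in> G"
    using noncommutative_translation[OF assms] .
  show "\<not> periodic_orbit G v" for v
    unfolding periodic_orbit_def by (rule translation_orbit_infinite[OF assms(1) t(2,1)])
  show "\<not> closed (orbit G v)" if ne: "G - sym_trans \<noteq> {}" and "countable G" for v
  proof
    assume cl: "closed (orbit G v)"
    obtain l a where la: "homothety l a \<in> G" "l \<noteq> 0" "\<bar>l\<bar> < 1"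
      using contracting_ratio[OF assms(1) ne] .
    have "orbit G v = (\<lambda>f. f v) ` G" by (auto simp: orbit_def)
    then have "countable (orbit G v)" using \<open>countable G\<close> by simp
    then show False
      using closed_orbit_uncountable[OF assms(1) t(2,1) la cl] by contradiction
  qed
  show "minimal_orbit G v" if "G \<subseteq> sym_trans" for v
    unfolding minimal_orbit_def
    \<comment> \<open>Monotonicity gives one inclusion of the closures; by symmetry \<open>v\<close>
      lies in the closure of the orbit of \<open>w\<close>, so monotonicity also gives the
      other.\<close>
    using closure_orbit_mono[OF assms(1)] closure_orbit_sym[OF assms(1) that] by blast
qed

end
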